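(* Let $M\ge 1$, let $f_1,\dots,f_M$ be location-scale families of densities on $\mathbb{R}$, let $f(x;\theta)$, $\theta\in\Theta$, be the corresponding $M$-component mixture, and let $\theta_0\in\Theta$, $f_0(x)=f(x;\theta_0)$. Assume: (i) there are real constants $v_0,v_1>0$ and $\beta>1$ such that $f_m(x;\mu_m=0,\sigma_m=1)\le\min\{v_0,\,v_1|x|^{-\beta}\}$ for all $x$ and all $m$; (ii) for every compact $\Gamma\subset\Theta$, each $\theta\in\Gamma$ and all sufficiently small $\rho>0$, the function $x\mapsto f(x;\theta,\rho)=\sup_{\operatorname{dist}(\theta',\theta)\le\rho}f(x;\theta')$ is measurable; (iii) for every compact $\Gamma\subset\Theta$ and each $\theta\in\Gamma$, if $\theta^{(j)}\in\Gamma$ and $\lim_{j\to\infty}\theta^{(j)}=\theta$, then $\lim_{j\to\infty}f(x;\theta^{(j)})=f(x;\theta)$ except on a null set of $x$ which does not depend on the sequence $\{\theta^{(j)}\}$; (iv) $\int|\log f(x;\theta_0)|\,f(x;\theta_0)\,dx<\infty$. Suppose moreover that $f_0\in\mathscr{G}_M\setminus\mathscr{G}_{M-1}$. Then there exist real constants $\kappa,\lambda>0$ such that $$E_0\left[\log\{g(x)+\kappa\}\right]+\lambda<E_0[\log f(x;\theta_0)]\qquad\text{for all } g\in\mathscr{G}_{M-1}.$$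
   Context: For $m=1,\dots,M$, $f_m(x;\mu_m,\sigma_m)=\frac1{\sigma_m}f_m\left(\frac{x-\mu_m}{\sigma_m};0,1\right)$ is a location-scale family of probability densities on $\mathbb{R}$ with $\mu_m\in\mathbb{R}$, $\sigma_m>0$ (different $m$ may use different families). The parameter is $\theta=(\alpha_1,\mu_1,\sigma_1,\dots,\alpha_M,\mu_M,\sigma_M)$; $\Theta$ is the set of such $\theta$ with $\alpha_m\ge0$, $\sum_{m=1}^M\alpha_m=1$, $\mu_m\in\mathbb{R}$, $\sigma_m\in(0,\infty)$. The mixture density is $f(x;\theta)=\sum_{m=1}^M\alpha_m f_m(x;\mu_m,\sigma_m)$. $\operatorname{dist}$ is Euclidean distance between parameter vectors. For $\mathscr{K}\subset\{1,\dots,M\}$, $\theta_{\mathscr{K}}$ is the subvector of $\theta$ consisting of the components in $\mathscr{K}$; $\bar\Theta_{\mathscr{K}}=\{\theta_{\mathscr{K}}\mid\theta\in\Theta,\ \sum_{m\in\mathscr{K}}\alpha_m\le1\}$; $f_{\mathscr{K}}(x;\theta_{\mathscr{K}})=\sum_{k\in\mathscr{K}}\alpha_kf_k(x;\mu_k,\sigma_k)$; $\mathscr{G}_{\mathscr{K}}=\{f_{\mathscr{K}}(\cdot;\theta_{\mathscr{K}})\mid\theta_{\mathscr{K}}\in\bar\Theta_{\mathscr{K}}\}$; and $\mathscr{G}_K=\bigcup_{|\mathscr{K}|\le K}\mathscr{G}_{\mathscr{K}}$ is the set of subprobability densities with no more than $K$ components. $E_0[\cdot]$ denotes expectation when $x$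 has density $f(x;\theta_0)$.
   Formalization: The classes G_K are read up to almost-everywhere equality: f_0 not in G_{M-1} means f_0 is not a.e. equal to any subprobability density with at most M-1 components; with pointwise equality the claim fails if f_0 differs from such a density only on a null set. *)

theory Defs
  imports "HOL-Analysis.Analysis"
begin

definition prob_density :: "(real \<Rightarrow> real) \<Rightarrow> bool" where
  "prob_density h \<longleftrightarrow>
     h \<in> borel_measurable lebesgue \<and> (\<forall>x. 0 \<le> h x) \<and> (\<integral>\<^sup>+ x. ennreal (h x) \<partial>lebesgue) = 1"

text \<open>Argument order: \<open>F x \<mu> \<sigma>\<close> stands for \<open>F(x; \<mu>, \<sigma>)\<close>.\<close>

definition location_scale_family :: "(real \<Rightarrow> real \<Rightarrow> real \<Rightarrow> real) \<Rightarrow> bool" where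
  "location_scale_family F \<longleftrightarrow>
     (\<forall>\<mu> \<sigma>. \<sigma> > 0 \<longrightarrow>
        prob_density (\<lambda>x. F x \<mu> \<sigma>) \<and> (\<forall>x. F x \<mu> \<sigma> = 1 / \<sigma> * F ((x - \<mu>) / \<sigma>) 0 1))"

text \<open>The components are indexed by a finite type \<open>'m\<close>, so the number of components is
  \<open>M = CARD('m)\<close>. A component parameter is a triple \<open>(\<alpha>, \<mu>, \<sigma>)\<close>. The library metric on
  \<open>(real \<times> real \<times> real) ^ 'm\<close> is the Euclidean distance on real \<open>3M\<close>-space.\<close>

type_synonym component = "real \<times> real \<times> real"

definition wgt :: "component \<Rightarrow> real" where "wgt p = fst p"
definition loc :: "component \<Rightarrow> real" where "loc p = fst (snd p)"
definition scl :: "component \<Rightarrow> real" where "scl p = snd (snd p)"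

definition Theta :: "(component ^ 'm::finite) set" where
  "Theta = {\<theta>. (\<forall>m. 0 \<le> wgt (\<theta> $ m)) \<and> (\<Sum>m\<in>UNIV. wgt (\<theta> $ m)) = 1 \<and> (\<forall>m. 0 < scl (\<theta> $ m))}"

definition mixture ::
  "('m::finite \<Rightarrow> real \<Rightarrow> real \<Rightarrow> real \<Rightarrow> real) \<Rightarrow> real \<Rightarrow> component ^ 'm \<Rightarrow> real" where
  "mixture f x \<theta> = (\<Sum>m\<in>UNIV. wgt (\<theta> $ m) * f m x (loc (\<theta> $ m)) (scl (\<theta> $ m)))"

text \<open>The supremum is taken in the extended reals, so that it is meaningful for every radius.\<close>

definition mixture_sup ::
  "('m::finite \<Rightarrow> real \<Rightarrow> real \<Rightarrow> real \<Rightarrow> real) \<Rightarrow> real \<Rightarrow> component ^ 'm \<Rightarrow> real \<Rightarrow> ereal" where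
  "mixture_sup f x \<theta> \<rho> = (SUP \<theta>' \<in> {\<theta>' \<in> Theta. dist \<theta>' \<theta> \<le> \<rho>}. ereal (mixture f x \<theta>'))"

text \<open>Subvectors are extensional functions on the index set \<open>K\<close>.\<close>

definition subvector :: "'m set \<Rightarrow> component ^ 'm::finite \<Rightarrow> 'm \<Rightarrow> component" where
  "subvector K \<theta> = restrict (\<lambda>m. \<theta> $ m) K"

definition Theta_bar :: "'m::finite set \<Rightarrow> ('m \<Rightarrow> component) set" where
  "Theta_bar K = {subvector K \<theta> | \<theta>. \<theta> \<in> Theta \<and> (\<Sum>m\<in>K. wgt (\<theta> $ m)) \<le> 1}"

definition submixture ::
  "('m::finite \<Rightarrow> real \<Rightarrow> real \<Rightarrow> real \<Rightarrow> real) \<Rightarrow> 'm set \<Rightarrow> real \<Rightarrow> ('m \<Rightarrow> component) \<Rightarrow> real" where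
  "submixture f K x t = (\<Sum>k\<in>K. wgt (t k) * f k x (loc (t k)) (scl (t k)))"

text \<open>Densities are determined only up to Lebesgue null sets, so the classes below contain every
  nonnegative version of a submixture. In particular, not belonging to such a class
  means differing from each of its submixtures on a set of positive measure.\<close>

definition G_set ::
  "('m::finite \<Rightarrow> real \<Rightarrow> real \<Rightarrow> real \<Rightarrow> real) \<Rightarrow> 'm set \<Rightarrow> (real \<Rightarrow> real) set" where
  "G_set f K = {g. (\<forall>x. 0 \<le> g x) \<and> (\<exists>t\<in>Theta_bar K. AE x in lebesgue. g x = submixture f K x t)}"

definition G_upto ::
  "('m::finite \<Rightarrow> real \<Rightarrow> real \<Rightarrow> real \<Rightarrow> real) \<Rightarrow> nat \<Rightarrow> (real \<Rightarrow> real) set" where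
  "G_upto f n = (\<Union>K\<in>{K. card K \<le> n}. G_set f K)"

definition expect_under ::
  "('m::finite \<Rightarrow> real \<Rightarrow> real \<Rightarrow> real \<Rightarrow> real) \<Rightarrow> component ^ 'm \<Rightarrow> (real \<Rightarrow> real) \<Rightarrow> real" where
  "expect_under f \<theta> h = integral\<^sup>L (density lebesgue (\<lambda>x. ennreal (mixture f x \<theta>))) h"

end

theory Submission
  imports Defs
begin

text \<open>Write \<open>h\<close> for the true density and measure how far a subdensity \<open>g\<close> is from it by the deficit
  \<open>D g = \<integral> max 0 (h - g)\<close>. The theorem splits into two statements about \<open>D\<close>.

  First, a deficit of at least \<open>\<delta> > 0\<close> forces a gap in expected logarithm that is uniform in \<open>g\<close>
  (\<open>log_gap_from_deficit\<close>). With \<open>t = (g + \<kappa>) / (h + \<kappa>)\<close>, a strengthening of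
  \<open>ln t \<le> t - 1\<close> by a multiple of \<open>max 0 (1 - t)\<close> (\<open>ln_le_linear_minus_deficit\<close>) bounds
  \<open>\<integral> h ln (g + \<kappa>)\<close> by \<open>\<integral> h ln (h + \<kappa>) - c \<delta> + c\<^sup>2\<close> plus an error term that depends on
  \<open>\<kappa>\<close> but not on \<open>g\<close>. As \<open>\<kappa>\<close> tends to \<open>0\<close>, dominated convergence removes the error and turns
  \<open>h + \<kappa>\<close> into \<open>h\<close> (\<open>smoothing_terms_limit\<close>), and \<open>c = min \<delta> 1 / 2\<close> leaves a gap of order \<open>c\<^sup>2\<close>.

  Second, \<open>D\<close> is bounded below on the subdensities supported on a fixed proper set \<open>K\<close> of components
  (\<open>deficit_bounded_below\<close>). This is a compactness argument: along a subsequence all weights,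
  locations and scales converge in the extended reals. A component whose location escapes to
  infinity, or whose scale tends to \<open>0\<close> or to infinity, tends to \<open>0\<close> almost everywhere because of its
  bounded height and polynomial tail; every other component converges almost everywhere to a
  component of the same family. The limit is thus again a submixture on \<open>K\<close>, possibly of smaller
  total weight (\<open>submixture_subsequence\<close>), and \<open>D\<close> passes to the limit because \<open>max 0 (h - g)\<close>
  is dominated by \<open>h\<close>. A limit with \<open>D = 0\<close> would equal \<open>h\<close> almost everywhere, but \<open>h\<close> is not a
  submixture on a proper set of components. Finally there are only finitely many sets \<open>K\<close>.

  Working with the deficit instead of with the logarithms in the compactness step is what avoids a
  dominating function for \<open>ln g\<close> when scales degenerate and densities become unbounded.\<close>

section \<open>A logarithmic gap from an integrated deficit\<close>

text \<open>For \<open>t \<le> 1\<close> the right-hand side is \<open>(1 + c) * t - 1 - (c - c\<^sup>2)\<close>, which lies above the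
  tangent of \<open>ln\<close> at \<open>1 / (1 + c)\<close>, since \<open>ln (1 + c) \<ge> c - c\<^sup>2\<close>. The extra slope below \<open>1\<close> costs
  only the second-order term \<open>c\<^sup>2\<close>, so a small \<open>c\<close> makes any deficit profitable.\<close>

lemma ln_le_linear_minus_deficit:
  fixes t c :: real
  assumes "0 < t" "0 \<le> c" "c \<le> 1"
  shows "ln t \<le> (t - 1) - c * max 0 (1 - t) + c\<^sup>2"
proof (cases "t \<le> 1")
  case True
  have "ln t = ln ((1 + c) * t) - ln (1 + c)"
    using assms by (simp add: ln_mult)
  also have "\<dots> \<le> ((1 + c) * t - 1) - (c - c\<^sup>2)"
    using ln_le_minus_one[of "(1 + c) * t"] ln_one_plus_pos_lower_bound[of c] assms by auto
  also have "\<dots> = (t - 1) - c * max 0 (1 - t) + c\<^sup>2"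
    using True by (simp add: algebra_simps)
  finally show ?thesis .
next
  case False
  show ?thesis
  proof -
    have "c * max 0 (1 - t) = 0" using False by simp
    then show ?thesis using ln_le_minus_one[of t] assms(1) zero_le_power2[of c]
      by linarith
  qed
qed

text \<open>This is the previous bound at \<open>t = (g + \<kappa>) / (h + \<kappa>)\<close>, multiplied by \<open>h\<close>. The factor
  \<open>h / (h + \<kappa>)\<close> in front of \<open>g - h\<close> and of the deficit is replaced by \<open>1\<close>; each replacement
  costs at most a multiple of \<open>h * \<kappa> / (h + \<kappa>)\<close>, which does not involve \<open>g\<close>.\<close>

lemma weighted_ln_le:
  fixes h g \<kappa> c :: real
  assumes "0 \<le> h" "0 \<le> g" "0 < \<kappa>" "0 \<le> c" "c \<le> 1"
  shows "h * ln (g + \<kappa>) \<le> h * ln (h + \<kappa>) + (g - h) + (1 + c) * (h * \<kappa> / (h + \<kappa>))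
           - c * max 0 (h - g) + c\<^sup>2 * h"
proof -
  define t w where "t = (g + \<kappa>) / (h + \<kappa>)" and "w = \<kappa> / (h + \<kappa>)"
  have t: "t > 0" and w: "0 \<le> w" "w \<le> 1" using assms by (auto simp: t_def w_def)
  have hw: "h * \<kappa> / (h + \<kappa>) = h * w" by (simp add: w_def)
  have ht: "h * (t - 1) = (1 - w) * (g - h)" "h * (1 - t) = (1 - w) * (h - g)"
    using assms by (simp_all add: t_def w_def field_simps)
  have "h * max 0 (1 - t) = (1 - w) * max 0 (h - g)"
    using ht(2) assms w by (simp add: max_mult_distrib_left)
  also have "\<dots> \<ge> max 0 (h - g) - h * w"
    using mult_left_mono[of "max 0 (h - g)" h w] assms w by (simp add: algebra_simps)
  finally have def: "c * (max 0 (h - g) - h * w) \<le> c * (h * max 0 (1 - t))"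
    using assms by (intro mult_left_mono) auto
  have "ln t = ln (g + \<kappa>) - ln (h + \<kappa>)"
    using assms by (simp add: t_def ln_div)
  then have "h * ln (g + \<kappa>) = h * ln (h + \<kappa>) + h * ln t" by (simp add: right_diff_distrib)
  also have "h * ln t \<le> h * ((t - 1) - c * max 0 (1 - t) + c\<^sup>2)"
    using ln_le_linear_minus_deficit[of t c] t assms by (intro mult_left_mono) auto
  also have "\<dots> = (1 - w) * (g - h) - c * (h * max 0 (1 - t)) + c\<^sup>2 * h"
    using ht(1) by (simp add: algebra_simps)
  also have "\<dots> \<le> (1 - w) * (g - h) - c * (max 0 (h - g) - h * w) + c\<^sup>2 * h"
    using def by simp
  also have "\<dots> \<le> (g - h) + h * w - c * (max 0 (h - g) - h * w) + c\<^sup>2 * h"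
    using mult_nonneg_nonneg[of w g] assms w by (simp add: algebra_simps)
  finally show ?thesis unfolding hw by (simp add: algebra_simps)
qed

text \<open>The two terms of the bound in which \<open>\<kappa>\<close> occurs, along a sequence of values \<open>k n\<close> of \<open>\<kappa>\<close>.
  For \<open>\<kappa> \<le> 1\<close> one has \<open>ln h \<le> ln (h + \<kappa>) \<le> \<bar>ln h\<bar> + 1\<close> wherever \<open>h > 0\<close>, hence
  \<open>(\<bar>ln h\<bar> + 1) * h\<close> dominates the first; \<open>h\<close> itself dominates the second.\<close>

lemma smoothing_terms_limit:
  fixes h :: "'a \<Rightarrow> real" and k :: "nat \<Rightarrow> real"
  assumes h: "integrable M h" "\<And>x. 0 \<le> h x"
    and log_int: "integrable M (\<lambda>x. \<bar>ln (h x)\<bar> * h x)"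
    and k: "\<And>n. 0 < k n" "\<And>n. k n \<le> 1" and k0: "k \<longlonglongrightarrow> 0"
  shows "\<And>n. integrable M (\<lambda>x. h x * ln (h x + k n))"
    and "(\<lambda>n. \<integral>x. h x * ln (h x + k n) \<partial>M) \<longlonglongrightarrow> (\<integral>x. h x * ln (h x) \<partial>M)"
    and "\<And>n. integrable M (\<lambda>x. h x * k n / (h x + k n))"
    and "(\<lambda>n. \<integral>x. h x * k n / (h x + k n) \<partial>M) \<longlonglongrightarrow> 0"
proof -
  note [measurable] = borel_measurable_integrable[OF h(1)]
  define w where "w = (\<lambda>x. \<bar>ln (h x)\<bar> * h x + h x)"
  have w: "integrable M w" unfolding w_def using h(1) log_int by simp
  have b1: "norm (h x * ln (h x + k n)) \<le> w x" for x n
  proof (cases "h x = 0")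
    case False
    then have p: "h x > 0" using h(2)[of x] by simp
    have lo: "ln (h x) \<le> ln (h x + k n)" using p k(1)[of n] k(2)[of n] by simp
    have "ln (h x + k n) \<le> ln (h x + 1)" using p k(1)[of n] k(2)[of n] by simp
    also have "\<dots> \<le> \<bar>ln (h x)\<bar> + 1"
    proof (cases "h x \<le> 1")
      case True
      then show ?thesis using ln_add_one_self_le_self[of "h x"] p abs_ge_zero[of "ln (h x)"]
        unfolding add.commute[of "h x" 1] by linarith
    next
      case False
      have "ln (h x + 1) \<le> ln (h x * 2)" using p False by simp
      also have "\<dots> = ln (h x) + ln 2" using p by (simp add: ln_mult)
      also have "\<dots> \<le> \<bar>ln (h x)\<bar> + 1" using ln_le_minus_one[of 2] by simp
      finally show ?thesis .
    qed
    finally have "\<bar>ln (h x + k n)\<bar> \<le> \<bar>ln (h x)\<bar> + 1" using lo by linarith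
    then have "h x * \<bar>ln (h x + k n)\<bar> \<le> h x * (\<bar>ln (h x)\<bar> + 1)"
      using p by (intro mult_left_mono) auto
    then show ?thesis using p by (simp add: w_def abs_mult algebra_simps)
  qed (simp add: w_def)
  have b2: "norm (h x * k n / (h x + k n)) \<le> h x" for x n
  proof -
    have "h x * k n \<le> h x * (h x + k n)" using h(2)[of x] by (simp add: algebra_simps)
    then show ?thesis using h(2)[of x] k(1)[of n] k(2)[of n] by (simp add: divide_le_eq add_nonneg_pos)
  qed
  have l1: "(\<lambda>n. h x * ln (h x + k n)) \<longlonglongrightarrow> h x * ln (h x)" for x
  proof (cases "h x = 0")
    case False
    have "(\<lambda>n. h x + k n) \<longlonglongrightarrow> h x + 0" by (intro tendsto_add tendsto_const k0)
    then show ?thesis using False by (intro tendsto_intros) auto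
  qed simp
  have l2: "(\<lambda>n. h x * k n / (h x + k n)) \<longlonglongrightarrow> 0" for x
  proof (cases "h x = 0")
    case False
    have "(\<lambda>n. h x * k n / (h x + k n)) \<longlonglongrightarrow> h x * 0 / (h x + 0)"
      using False by (intro tendsto_intros k0) auto
    then show ?thesis by simp
  qed simp
  show "integrable M (\<lambda>x. h x * ln (h x + k n))" for n
    by (rule Bochner_Integration.integrable_bound[OF w]) (use b1 in \<open>auto intro: order_trans[OF _ abs_ge_self]\<close>)
  show "integrable M (\<lambda>x. h x * k n / (h x + k n))" for n
    by (rule Bochner_Integration.integrable_bound[OF h(1)]) (use b2 in \<open>auto intro: order_trans[OF _ abs_ge_self]\<close>)
  show "(\<lambda>n. \<integral>x. h x * ln (h x + k n) \<partial>M) \<longlonglongrightarrow> (\<integral>x. h x * ln (h x) \<partial>M)"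
    by (rule integral_dominated_convergence[where w = w]) (use w b1 l1 in auto)
  have "(\<lambda>n. \<integral>x. h x * k n / (h x + k n) \<partial>M) \<longlonglongrightarrow> (\<integral>x. 0 \<partial>M)"
    by (rule integral_dominated_convergence[where w = h]) (use h b2 l2 in auto)
  then show "(\<lambda>n. \<integral>x. h x * k n / (h x + k n) \<partial>M) \<longlonglongrightarrow> 0" by simp
qed

lemma integrable_deficit:
  fixes h g :: "'a \<Rightarrow> real"
  assumes "integrable M h" "g \<in> borel_measurable M" "\<And>x. 0 \<le> h x" "\<And>x. 0 \<le> g x"
  shows "integrable M (\<lambda>x. max 0 (h x - g x))"
  by (rule Bochner_Integration.integrable_bound[OF assms(1)]) (use assms in \<open>auto simp: max_def intro: order_trans\<close>)

text \<open>The quantifier order matters: \<open>\<kappa>\<close> and \<open>l\<close> are chosen before \<open>g\<close>. This is possible because \<open>g\<close>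
  enters the integrated bound only through its mass and its deficit.\<close>

lemma log_gap_from_deficit:
  fixes h :: "'a \<Rightarrow> real"
  assumes h: "integrable M h" "\<And>x. 0 \<le> h x" "(\<integral>x. h x \<partial>M) = 1"
    and log_int: "integrable M (\<lambda>x. \<bar>ln (h x)\<bar> * h x)"
    and \<delta>: "0 < \<delta>"
  shows "\<exists>\<kappa> l. 0 < \<kappa> \<and> 0 < l \<and> (\<forall>g. integrable M g \<longrightarrow> (\<forall>x. 0 \<le> g x) \<longrightarrow> (\<integral>x. g x \<partial>M) \<le> 1 \<longrightarrow>
     \<delta> \<le> (\<integral>x. max 0 (h x - g x) \<partial>M) \<longrightarrow>
     (\<integral>x. h x * ln (g x + \<kappa>) \<partial>M) + l < (\<integral>x. h x * ln (h x) \<partial>M))"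
proof -
  define k where "k = (\<lambda>n::nat. 1 / real (Suc n))"
  have k: "0 < k n" "k n \<le> 1" for n by (auto simp: k_def)
  have k0: "k \<longlonglongrightarrow> 0"
    unfolding k_def using LIMSEQ_inverse_real_of_nat by (simp add: inverse_eq_divide)
  note lims = smoothing_terms_limit[OF h(1,2) log_int k k0]
  \<comment> \<open>The gain minus the cost is \<open>c * \<delta> - c\<^sup>2 \<ge> c\<^sup>2\<close>; one half of it absorbs the error from
    \<open>\<kappa>\<close>, the other half is the gap. The minimum keeps \<open>c\<close> within the range of the logarithm
    bound.\<close>
  define c where "c = min \<delta> 1 / 2"
  have c: "0 < c" "c \<le> 1" "2 * c \<le> \<delta>" using \<delta> by (auto simp: c_def)
  define R where "R = (\<lambda>n. (\<integral>x. h x * ln (h x + k n) \<partial>M) + (1 + c) * (\<integral>x. h x * k n / (h x + k n) \<partial>M))"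
  have "R \<longlonglongrightarrow> (\<integral>x. h x * ln (h x) \<partial>M) + (1 + c) * 0"
    unfolding R_def by (intro tendsto_intros lims)
  moreover have "(\<integral>x. h x * ln (h x) \<partial>M) + (1 + c) * 0 < (\<integral>x. h x * ln (h x) \<partial>M) + c\<^sup>2 / 2"
    using c by simp
  ultimately have "eventually (\<lambda>n. R n < (\<integral>x. h x * ln (h x) \<partial>M) + c\<^sup>2 / 2) sequentially"
    by (rule order_tendstoD(2))
  then obtain n where n: "R n < (\<integral>x. h x * ln (h x) \<partial>M) + c\<^sup>2 / 2"
    by (auto simp: eventually_sequentially)
  define \<kappa> where "\<kappa> = k n"
  have \<kappa>: "0 < \<kappa>" by (simp add: \<kappa>_def k_def)
  have "(\<integral>x. h x * ln (g x + \<kappa>) \<partial>M) + c\<^sup>2 / 2 < (\<integral>x. h x * ln (h x) \<partial>M)"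
    if g: "integrable M g" "\<forall>x. 0 \<le> g x" "(\<integral>x. g x \<partial>M) \<le> 1"
      and D: "\<delta> \<le> (\<integral>x. max 0 (h x - g x) \<partial>M)" for g
  proof -
    note [measurable] = borel_measurable_integrable[OF h(1)] borel_measurable_integrable[OF g(1)]
    define U where "U = (\<lambda>x. h x * ln (h x + \<kappa>) + (g x - h x) + (1 + c) * (h x * \<kappa> / (h x + \<kappa>))
           - c * max 0 (h x - g x) + c\<^sup>2 * h x)"
    have dint: "integrable M (\<lambda>x. max 0 (h x - g x))"
      by (rule integrable_deficit) (use h g in auto)
    note ints = lims(1)[of n, folded \<kappa>_def] lims(3)[of n, folded \<kappa>_def] g(1) h(1) dint
    have U: "integrable M U" unfolding U_def
      by (intro Bochner_Integration.integrable_add Bochner_Integration.integrable_diff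
          integrable_mult_right ints)
    have hU: "h x * ln (g x + \<kappa>) \<le> U x" for x
      unfolding U_def using weighted_ln_le[of "h x" "g x" \<kappa> c] h g \<kappa> c by auto
    have hL: "h x * ln \<kappa> \<le> h x * ln (g x + \<kappa>)" for x
      using h(2)[of x] g(2)[rule_format, of x] \<kappa> by (intro mult_left_mono) auto
    \<comment> \<open>Without integrability the integral would be the default value \<open>0\<close>. Here it follows from
      the upper bound \<open>U\<close> and the lower bound \<open>h * ln \<kappa>\<close>.\<close>
    have "integrable M (\<lambda>x. h x * ln (g x + \<kappa>))"
    proof (rule Bochner_Integration.integrable_bound)
      show "integrable M (\<lambda>x. \<bar>U x\<bar> + \<bar>h x * ln \<kappa>\<bar>)" using U h(1) by simp
      show "AE x in M. norm (h x * ln (g x + \<kappa>)) \<le> norm (\<bar>U x\<bar> + \<bar>h x * ln \<kappa>\<bar>)"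
      proof (rule AE_I2)
        fix x show "norm (h x * ln (g x + \<kappa>)) \<le> norm (\<bar>U x\<bar> + \<bar>h x * ln \<kappa>\<bar>)"
          using hU[of x] hL[of x] unfolding real_norm_def by linarith
      qed
    qed measurable
    then have "(\<integral>x. h x * ln (g x + \<kappa>) \<partial>M) \<le> (\<integral>x. U x \<partial>M)"
      using U hU by (intro integral_mono) auto
    also have "\<dots> = R n + ((\<integral>x. g x \<partial>M) - 1) - c * (\<integral>x. max 0 (h x - g x) \<partial>M) + c\<^sup>2"
      unfolding U_def R_def \<kappa>_def[symmetric]
      by (simp add: ints(1) ints(2)[THEN integrable_mult_right, of "1 + c", simplified] ints(2-) h(3) del: times_divide_eq_right)
    also have "\<dots> \<le> R n - c * (2 * c) + c\<^sup>2"
    proof -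
      have "c * (2 * c) \<le> c * (\<integral>x. max 0 (h x - g x) \<partial>M)"
        using c D by (intro mult_left_mono) auto
      then show ?thesis using g(3) by linarith
    qed
    finally show ?thesis using n by (simp add: power2_eq_square)
  qed
  then show ?thesis using \<kappa> c by (intro exI[of _ \<kappa>] exI[of _ "c\<^sup>2 / 2"]) auto
qed

section \<open>Subsequential limits of components\<close>

text \<open>The limit weight may be smaller than the limit of the weights: mass that disappears
  with a degenerating component is recorded as weight \<open>0\<close> on an arbitrary parameter. This
  way a degenerate limit needs no separate case later.\<close>

definition component_limit ::
  "(real \<Rightarrow> real \<Rightarrow> real \<Rightarrow> real) \<Rightarrow> (nat \<Rightarrow> component) \<Rightarrow> component \<Rightarrow> bool" where
  "component_limit F p q \<longleftrightarrow> 0 \<le> wgt q \<and> 0 < scl q \<and>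
     (\<exists>a \<ge> wgt q. (\<lambda>n. wgt (p n)) \<longlonglongrightarrow> a) \<and>
     (AE x in lebesgue. (\<lambda>n. wgt (p n) * F x (loc (p n)) (scl (p n)))
        \<longlonglongrightarrow> wgt q * F x (loc q) (scl q))"

lemma component_limit_subseq:
  assumes "component_limit F p q" "strict_mono r"
  shows "component_limit F (\<lambda>n. p (r n)) q"
proof -
  have sub: "(\<lambda>n. X (r n)) \<longlonglongrightarrow> L" if "X \<longlonglongrightarrow> L" for X :: "nat \<Rightarrow> real" and L
    using LIMSEQ_subseq_LIMSEQ[OF that assms(2)] by (simp add: o_def)
  obtain a where "a \<ge> wgt q" "(\<lambda>n. wgt (p n)) \<longlonglongrightarrow> a"
    using assms(1) by (auto simp: component_limit_def)
  then have "\<exists>a \<ge> wgt q. (\<lambda>n. wgt (p (r n))) \<longlonglongrightarrow> a"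
    using sub[of "\<lambda>n. wgt (p n)" a] by auto
  moreover have "AE x in lebesgue. (\<lambda>n. wgt (p (r n)) * F x (loc (p (r n))) (scl (p (r n))))
        \<longlonglongrightarrow> wgt q * F x (loc q) (scl q)"
    using assms(1)[unfolded component_limit_def, THEN conjunct2, THEN conjunct2, THEN conjunct2]
    by eventually_elim (rule sub)
  ultimately show ?thesis using assms(1) by (simp add: component_limit_def)
qed

text \<open>Continuity along sequences of parameters holds almost everywhere only, and the exceptional null
  set may depend on the sequence: limits are taken along one sequence at a time.\<close>

locale tail_bounded_family =
  fixes F :: "real \<Rightarrow> real \<Rightarrow> real \<Rightarrow> real" and v\<^sub>0 v\<^sub>1 \<beta> :: real
  assumes family: "location_scale_family F"
    and constants: "0 < v\<^sub>0" "0 < v\<^sub>1" "1 < \<beta>"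
    and height: "\<And>x. F x 0 1 \<le> v\<^sub>0"
    and tail: "\<And>x. x \<noteq> 0 \<Longrightarrow> F x 0 1 \<le> v\<^sub>1 * \<bar>x\<bar> powr (- \<beta>)"
    and continuity: "\<And>\<mu>s \<sigma>s \<mu> \<sigma>. \<mu>s \<longlonglongrightarrow> \<mu> \<Longrightarrow> \<sigma>s \<longlonglongrightarrow> \<sigma> \<Longrightarrow> (\<And>n. 0 < \<sigma>s n) \<Longrightarrow> 0 < \<sigma> \<Longrightarrow>
      AE x in lebesgue. (\<lambda>n. F x (\<mu>s n) (\<sigma>s n)) \<longlonglongrightarrow> F x \<mu> \<sigma>"
begin

lemma nonneg: "0 < \<sigma> \<Longrightarrow> 0 \<le> F x \<mu> \<sigma>"
  using family unfolding location_scale_family_def prob_density_def by blast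

lemma rescale: "0 < \<sigma> \<Longrightarrow> F x \<mu> \<sigma> = 1 / \<sigma> * F ((x - \<mu>) / \<sigma>) 0 1"
  using family unfolding location_scale_family_def by blast

lemma le_height:
  assumes "0 < \<sigma>" shows "F x \<mu> \<sigma> \<le> v\<^sub>0 * inverse \<sigma>"
proof -
  have "F x \<mu> \<sigma> \<le> 1 / \<sigma> * v\<^sub>0"
    unfolding rescale[OF assms, of x \<mu>] using assms by (intro mult_left_mono height) auto
  then show ?thesis by (simp add: field_simps)
qed

text \<open>The power \<open>\<beta> - 1\<close> of the scale is positive, so narrow components are small away from their
  location; this is where \<open>\<beta> > 1\<close> enters.\<close>

lemma le_tail:
  assumes "0 < \<sigma>" "x \<noteq> \<mu>"
  shows "F x \<mu> \<sigma> \<le> v\<^sub>1 * \<sigma> powr (\<beta> - 1) * \<bar>x - \<mu>\<bar> powr (- \<beta>)"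
proof -
  have "F x \<mu> \<sigma> \<le> 1 / \<sigma> * (v\<^sub>1 * \<bar>(x - \<mu>) / \<sigma>\<bar> powr (- \<beta>))"
    unfolding rescale[OF assms(1), of x \<mu>] using assms by (intro mult_left_mono tail) auto
  also have "\<dots> = v\<^sub>1 * \<sigma> powr (\<beta> - 1) * \<bar>x - \<mu>\<bar> powr (- \<beta>)"
  proof -
    have "\<bar>(x - \<mu>) / \<sigma>\<bar> powr (- \<beta>) = \<bar>x - \<mu>\<bar> powr (- \<beta>) * \<sigma> powr \<beta>"
      using assms by (simp add: powr_divide powr_minus_divide)
    moreover have "\<sigma> powr (\<beta> - 1) = \<sigma> powr \<beta> / \<sigma>"
      using assms by (simp add: powr_diff)
    ultimately show ?thesis by simp
  qed
  finally show ?thesis .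
qed

lemma le_tail_mono:
  assumes "0 < \<sigma>" "\<sigma> \<le> s" "0 < d" "d \<le> \<bar>x - \<mu>\<bar>"
  shows "F x \<mu> \<sigma> \<le> v\<^sub>1 * s powr (\<beta> - 1) * d powr (- \<beta>)"
proof -
  have "F x \<mu> \<sigma> \<le> v\<^sub>1 * \<sigma> powr (\<beta> - 1) * \<bar>x - \<mu>\<bar> powr (- \<beta>)"
    using assms by (intro le_tail) auto
  also have "\<dots> \<le> v\<^sub>1 * s powr (\<beta> - 1) * d powr (- \<beta>)"
    using assms constants by (intro mult_mono powr_mono2 powr_mono2') auto
  finally show ?thesis .
qed

lemma vanishes_if_scale_infinite:
  assumes pos: "\<And>n. 0 < \<sigma>s n" and s: "LIM n sequentially. \<sigma>s n :> at_top"
  shows "(\<lambda>n. F x (\<mu>s n) (\<sigma>s n)) \<longlonglongrightarrow> 0"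
proof (rule tendsto_sandwich[OF _ _ tendsto_const])
  show "\<forall>\<^sub>F n in sequentially. 0 \<le> F x (\<mu>s n) (\<sigma>s n)" using pos by (simp add: nonneg)
  show "\<forall>\<^sub>F n in sequentially. F x (\<mu>s n) (\<sigma>s n) \<le> v\<^sub>0 * inverse (\<sigma>s n)" using pos by (simp add: le_height)
  show "(\<lambda>n. v\<^sub>0 * inverse (\<sigma>s n)) \<longlonglongrightarrow> 0"
    by (intro tendsto_mult_right_zero tendsto_inverse_0_at_top s)
qed

lemma vanishes_if_location_infinite:
  assumes pos: "\<And>n. 0 < \<sigma>s n" and s: "\<sigma>s \<longlonglongrightarrow> \<sigma>"
    and m: "LIM n sequentially. \<bar>\<mu>s n\<bar> :> at_top"
  shows "(\<lambda>n. F x (\<mu>s n) (\<sigma>s n)) \<longlonglongrightarrow> 0"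
proof (rule tendsto_sandwich[OF _ _ tendsto_const])
  define d where "d = (\<lambda>n. - \<bar>x\<bar> + \<bar>\<mu>s n\<bar>)"
  have d: "LIM n sequentially. d n :> at_top"
    unfolding d_def by (rule filterlim_tendsto_add_at_top[OF tendsto_const m])
  show "\<forall>\<^sub>F n in sequentially. 0 \<le> F x (\<mu>s n) (\<sigma>s n)" using pos by (simp add: nonneg)
  have "\<forall>\<^sub>F n in sequentially. \<sigma>s n < \<sigma> + 1" using s by (rule order_tendstoD) simp
  moreover have "\<forall>\<^sub>F n in sequentially. 0 < d n"
    using d by (auto simp: filterlim_at_top_dense)
  ultimately show "\<forall>\<^sub>F n in sequentially. F x (\<mu>s n) (\<sigma>s n) \<le> v\<^sub>1 * (\<sigma> + 1) powr (\<beta> - 1) * d n powr (- \<beta>)"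
  proof eventually_elim
    case (elim n)
    then show ?case by (intro le_tail_mono pos) (auto simp: d_def)
  qed
  have "(\<lambda>n. d n powr (- \<beta>)) \<longlonglongrightarrow> 0" using constants by (intro tendsto_neg_powr d) auto
  then show "(\<lambda>n. v\<^sub>1 * (\<sigma> + 1) powr (\<beta> - 1) * d n powr (- \<beta>)) \<longlonglongrightarrow> 0"
    by (rule tendsto_mult_right_zero)
qed

lemma vanishes_if_scale_zero:
  assumes pos: "\<And>n. 0 < \<sigma>s n" and s: "\<sigma>s \<longlonglongrightarrow> 0" and m: "\<mu>s \<longlonglongrightarrow> \<mu>" and x: "x \<noteq> \<mu>"
  shows "(\<lambda>n. F x (\<mu>s n) (\<sigma>s n)) \<longlonglongrightarrow> 0"
proof (rule tendsto_sandwich[OF _ _ tendsto_const])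
  define d where "d = \<bar>x - \<mu>\<bar> / 2"
  have d: "0 < d" "d < \<bar>x - \<mu>\<bar>" using x by (auto simp: d_def)
  show "\<forall>\<^sub>F n in sequentially. 0 \<le> F x (\<mu>s n) (\<sigma>s n)" using pos by (simp add: nonneg)
  have "(\<lambda>n. \<bar>x - \<mu>s n\<bar>) \<longlonglongrightarrow> \<bar>x - \<mu>\<bar>" by (intro tendsto_intros m)
  then have "\<forall>\<^sub>F n in sequentially. d < \<bar>x - \<mu>s n\<bar>" using d(2) by (rule order_tendstoD)
  then show "\<forall>\<^sub>F n in sequentially. F x (\<mu>s n) (\<sigma>s n) \<le> v\<^sub>1 * \<sigma>s n powr (\<beta> - 1) * d powr (- \<beta>)"
  proof eventually_elim
    case (elim n)
    then show ?case using d by (intro le_tail_mono pos) auto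
  qed
  have "(\<lambda>n. \<sigma>s n powr (\<beta> - 1)) \<longlonglongrightarrow> 0"
    using pos constants by (intro tendsto_zero_powrI[OF s tendsto_const]) (simp_all add: less_imp_le)
  then show "(\<lambda>n. v\<^sub>1 * \<sigma>s n powr (\<beta> - 1) * d powr (- \<beta>)) \<longlonglongrightarrow> 0"
    by (intro tendsto_mult_left_zero tendsto_mult_right_zero)
qed

text \<open>The factor \<open>c\<close> is \<open>1\<close> if the parameters converge to a proper parameter, and \<open>0\<close> in all
  degenerate cases. Only a collapse of the scale at a finite location needs an exceptional
  point, namely that location.\<close>

lemma converges_or_vanishes:
  assumes pos: "\<And>n. 0 < \<sigma>s n"
    and s: "(\<lambda>n. ereal (\<sigma>s n)) \<longlonglongrightarrow> s" and m: "(\<lambda>n. ereal (\<mu>s n)) \<longlonglongrightarrow> m"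
  shows "\<exists>c \<mu> \<sigma>. 0 \<le> c \<and> c \<le> 1 \<and> 0 < \<sigma> \<and>
    (AE x in lebesgue. (\<lambda>n. F x (\<mu>s n) (\<sigma>s n)) \<longlonglongrightarrow> c * F x \<mu> \<sigma>)"
proof -
  have vanish: ?thesis if "AE x in lebesgue. (\<lambda>n. F x (\<mu>s n) (\<sigma>s n)) \<longlonglongrightarrow> 0"
    by (rule exI[of _ 0], rule exI[of _ 0], rule exI[of _ 1]) (use that in simp)
  have "0 \<le> s"
    by (rule tendsto_lowerbound[OF s]) (use pos in \<open>simp_all add: less_imp_le\<close>)
  then show ?thesis
  proof (cases s)
    case PInf
    then have "LIM n sequentially. \<sigma>s n :> at_top" using s by (simp add: tendsto_PInfty_eq_at_top)
    then show ?thesis using vanishes_if_scale_infinite[of \<sigma>s] pos by (intro vanish) simp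
  next
    case (real \<sigma>)
    then have s': "\<sigma>s \<longlonglongrightarrow> \<sigma>" using s by simp
    show ?thesis
    proof (cases "\<bar>m\<bar> = \<infinity>")
      case True
      have "(\<lambda>n. \<bar>ereal (\<mu>s n)\<bar>) \<longlonglongrightarrow> \<bar>m\<bar>" by (intro tendsto_intros m)
      then have "LIM n sequentially. \<bar>\<mu>s n\<bar> :> at_top"
        using True by (simp flip: tendsto_PInfty_eq_at_top)
      then show ?thesis using vanishes_if_location_infinite[of \<sigma>s \<sigma> \<mu>s] pos s' by (intro vanish) simp
    next
      case False
      then obtain \<mu> where "m = ereal \<mu>" by auto
      then have m': "\<mu>s \<longlonglongrightarrow> \<mu>" using m by simp
      show ?thesis
      proof (cases "\<sigma> = 0")
        case True
        have "AE x in lebesgue. x \<noteq> \<mu>" by (intro AE_completion AE_lborel_singleton)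
        then show ?thesis
          using vanishes_if_scale_zero[of \<sigma>s \<mu>s \<mu>] pos s' m' True
          by (intro vanish) (auto elim: eventually_mono)
      next
        case False
        then have "0 < \<sigma>" using \<open>0 \<le> s\<close> real by simp
        then show ?thesis using continuity[OF m' s' pos]
          by (intro exI[of _ 1] exI[of _ \<mu>] exI[of _ \<sigma>]) simp
      qed
    qed
  qed auto
qed

lemma component_subsequence:
  fixes p :: "nat \<Rightarrow> component"
  assumes p: "\<And>n. 0 \<le> wgt (p n)" "\<And>n. wgt (p n) \<le> 1" "\<And>n. 0 < scl (p n)"
  shows "\<exists>r q. strict_mono r \<and> component_limit F (\<lambda>n. p (r n)) q"
proof -
  obtain a r1 where r1: "strict_mono r1" "((\<lambda>n. ereal (wgt (p n))) \<circ> r1) \<longlonglongrightarrow> a"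
    using compact_complete_linorder[of "\<lambda>n. ereal (wgt (p n))"] by blast
  obtain s r2 where r2: "strict_mono r2" "((\<lambda>n. ereal (scl (p (r1 n)))) \<circ> r2) \<longlonglongrightarrow> s"
    using compact_complete_linorder[of "\<lambda>n. ereal (scl (p (r1 n)))"] by blast
  obtain m r3 where r3: "strict_mono r3" "((\<lambda>n. ereal (loc (p (r1 (r2 n))))) \<circ> r3) \<longlonglongrightarrow> m"
    using compact_complete_linorder[of "\<lambda>n. ereal (loc (p (r1 (r2 n))))"] by blast
  define r where "r = r1 \<circ> (r2 \<circ> r3)"
  have r: "strict_mono r" unfolding r_def using r1 r2 r3 by (auto intro!: strict_mono_o)
  have la: "(\<lambda>n. ereal (wgt (p (r n)))) \<longlonglongrightarrow> a"
    using LIMSEQ_subseq_LIMSEQ[OF r1(2) strict_mono_o[OF r2(1) r3(1)]] by (simp add: r_def o_def)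
  have ls: "(\<lambda>n. ereal (scl (p (r n)))) \<longlonglongrightarrow> s"
    using LIMSEQ_subseq_LIMSEQ[OF r2(2) r3(1)] by (simp add: r_def o_def)
  have lm: "(\<lambda>n. ereal (loc (p (r n)))) \<longlonglongrightarrow> m"
    using r3(2) by (simp add: r_def o_def)
  have "0 \<le> a" "a \<le> 1"
    using tendsto_lowerbound[OF la, of 0] tendsto_upperbound[OF la, of 1] p by auto
  then obtain w where w: "a = ereal w" "0 \<le> w" by (cases a) auto
  have lw: "(\<lambda>n. wgt (p (r n))) \<longlonglongrightarrow> w" using la w by simp
  obtain c \<mu> \<sigma> where c: "0 \<le> c" "c \<le> 1" "0 < \<sigma>"
    and lF: "AE x in lebesgue. (\<lambda>n. F x (loc (p (r n))) (scl (p (r n)))) \<longlonglongrightarrow> c * F x \<mu> \<sigma>"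
    using converges_or_vanishes[OF p(3) ls lm] by blast
  have "AE x in lebesgue. (\<lambda>n. wgt (p (r n)) * F x (loc (p (r n))) (scl (p (r n)))) \<longlonglongrightarrow> w * c * F x \<mu> \<sigma>"
    using lF by eventually_elim (use tendsto_mult[OF lw] in \<open>simp add: mult.assoc\<close>)
  then have "component_limit F (\<lambda>n. p (r n)) (w * c, \<mu>, \<sigma>)"
    using c w lw mult_left_mono[of c 1 w] by (auto simp: component_limit_def wgt_def loc_def scl_def)
  then show ?thesis using r by blast
qed

end

text \<open>Components are treated one after the other; limits already obtained survive the
  passage to a further subsequence.\<close>

lemma simultaneous_subsequence:
  fixes p :: "nat \<Rightarrow> 'k \<Rightarrow> component"
  assumes "finite K" and fam: "\<And>k. k \<in> K \<Longrightarrow> tail_bounded_family (f k) v\<^sub>0 v\<^sub>1 \<beta>"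
    and "\<And>n k. k \<in> K \<Longrightarrow> 0 \<le> wgt (p n k)" "\<And>n k. k \<in> K \<Longrightarrow> wgt (p n k) \<le> 1"
    and "\<And>n k. k \<in> K \<Longrightarrow> 0 < scl (p n k)"
  shows "\<exists>r q. strict_mono r \<and> (\<forall>k\<in>K. component_limit (f k) (\<lambda>n. p (r n) k) (q k))"
  using assms
proof (induction K rule: finite_induct)
  case empty
  show ?case by (intro exI[of _ id]) (simp add: strict_mono_def)
next
  case (insert j K)
  then obtain r q where r: "strict_mono r"
    and q: "\<And>k. k \<in> K \<Longrightarrow> component_limit (f k) (\<lambda>n. p (r n) k) (q k)"
  proof -
    have "\<exists>r q. strict_mono r \<and> (\<forall>k\<in>K. component_limit (f k) (\<lambda>n. p (r n) k) (q k))"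
      by (rule insert.IH) (use insert.prems in auto)
    then show ?thesis using that by blast
  qed
  interpret tail_bounded_family "f j" v\<^sub>0 v\<^sub>1 \<beta> using insert.prems by auto
  obtain r' qj where r': "strict_mono r'" and qj: "component_limit (f j) (\<lambda>n. p (r (r' n)) j) qj"
    using component_subsequence[of "\<lambda>n. p (r n) j"] insert.prems by auto
  have "component_limit (f k) (\<lambda>n. p ((r \<circ> r') n) k) ((q(j := qj)) k)" if "k \<in> insert j K" for k
    using that qj component_limit_subseq[OF q r'] by (cases "k = j") auto
  moreover have "strict_mono (r \<circ> r')" using r r' by (rule strict_mono_o)
  ultimately show ?case by blast
qed

section \<open>Mixtures and submixtures as subprobability densities\<close>

lemma location_scale_integral:
  assumes "location_scale_family F" "0 < \<sigma>"
  shows "integrable lebesgue (\<lambda>x. F x \<mu> \<sigma>)" "(\<integral>x. F x \<mu> \<sigma> \<partial>lebesgue) = 1" "0 \<le> F x \<mu> \<sigma>"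
proof -
  have d: "(\<lambda>x. F x \<mu> \<sigma>) \<in> borel_measurable lebesgue" "\<And>x. 0 \<le> F x \<mu> \<sigma>"
    "(\<integral>\<^sup>+ x. ennreal (F x \<mu> \<sigma>) \<partial>lebesgue) = 1"
    using assms unfolding location_scale_family_def prob_density_def by blast+
  show "integrable lebesgue (\<lambda>x. F x \<mu> \<sigma>)" by (rule integrableI_nonneg) (use d in auto)
  show "(\<integral>x. F x \<mu> \<sigma> \<partial>lebesgue) = 1" using d by (subst integral_eq_nn_integral) auto
  show "0 \<le> F x \<mu> \<sigma>" by (rule d(2))
qed

lemma mixture_integral:
  assumes fam: "\<And>m. location_scale_family (f m)" and \<theta>: "\<theta> \<in> Theta"
  shows "integrable lebesgue (\<lambda>x. mixture f x \<theta>)" "(\<integral>x. mixture f x \<theta> \<partial>lebesgue) = 1"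
    "0 \<le> mixture f x \<theta>"
proof -
  have \<sigma>: "\<And>m. 0 < scl (\<theta> $ m)" and w: "\<And>m. 0 \<le> wgt (\<theta> $ m)" "(\<Sum>m\<in>UNIV. wgt (\<theta> $ m)) = 1"
    using \<theta> by (auto simp: Theta_def)
  note F = location_scale_integral[OF fam \<sigma>]
  show "integrable lebesgue (\<lambda>x. mixture f x \<theta>)" "(\<integral>x. mixture f x \<theta> \<partial>lebesgue) = 1"
    unfolding mixture_def using F w(2) by simp_all
  show "0 \<le> mixture f x \<theta>"
    unfolding mixture_def using F(3) w(1) by (intro sum_nonneg mult_nonneg_nonneg)
qed

lemma Theta_bar_bounds:
  assumes "t \<in> Theta_bar K"
  shows "t \<in> extensional K" "k \<in> K \<Longrightarrow> 0 \<le> wgt (t k)" "k \<in> K \<Longrightarrow> wgt (t k) \<le> 1"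
    "k \<in> K \<Longrightarrow> 0 < scl (t k)" "(\<Sum>k\<in>K. wgt (t k)) \<le> 1"
proof -
  obtain \<theta> where t: "t = subvector K \<theta>" and \<theta>: "\<theta> \<in> Theta" "(\<Sum>m\<in>K. wgt (\<theta> $ m)) \<le> 1"
    using assms by (auto simp: Theta_bar_def)
  show "t \<in> extensional K" "k \<in> K \<Longrightarrow> 0 \<le> wgt (t k)" "k \<in> K \<Longrightarrow> 0 < scl (t k)"
    "(\<Sum>k\<in>K. wgt (t k)) \<le> 1" using \<theta> by (auto simp: t subvector_def Theta_def)
  have "k \<in> K \<Longrightarrow> wgt (\<theta> $ k) \<le> (\<Sum>m\<in>K. wgt (\<theta> $ m))"
    using \<theta> by (intro member_le_sum) (auto simp: Theta_def)
  then show "k \<in> K \<Longrightarrow> wgt (t k) \<le> 1" using \<theta>(2) by (auto simp: t subvector_def)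
qed

text \<open>On a proper index set the constraint that all weights sum to \<open>1\<close> becomes an inequality: a
  component outside \<open>K\<close> carries the missing weight. For \<open>K = UNIV\<close> this fails, so the set of
  submixtures is closed under loss of mass only for proper \<open>K\<close>.\<close>

lemma Theta_barI:
  fixes K :: "'m::finite set"
  assumes "K \<noteq> UNIV" "t \<in> extensional K" "\<And>k. k \<in> K \<Longrightarrow> 0 \<le> wgt (t k)"
    "\<And>k. k \<in> K \<Longrightarrow> 0 < scl (t k)" "(\<Sum>k\<in>K. wgt (t k)) \<le> 1"
  shows "t \<in> Theta_bar K"
proof -
  obtain j where j: "j \<notin> K" using assms(1) by auto
  define rest :: component where "rest = (1 - (\<Sum>k\<in>K. wgt (t k)), 0, 1)"
  define \<theta> :: "component ^ 'm"
    where "\<theta> = (\<chi> m. if m \<in> K then t m else if m = j then rest else (0, 0, 1))"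
  have "(\<Sum>m\<in>UNIV. wgt (\<theta> $ m)) = (\<Sum>m\<in>K. wgt (\<theta> $ m)) + (\<Sum>m\<in>-K. wgt (\<theta> $ m))"
    by (subst sum.union_disjoint[symmetric]) auto
  also have "(\<Sum>m\<in>K. wgt (\<theta> $ m)) = (\<Sum>k\<in>K. wgt (t k))" by (simp add: \<theta>_def)
  also have "(\<Sum>m\<in>-K. wgt (\<theta> $ m)) = (\<Sum>m\<in>-K. if m = j then wgt rest else 0)"
    by (intro sum.cong) (auto simp: \<theta>_def wgt_def)
  also have "\<dots> = wgt rest" using j by simp
  finally have "(\<Sum>m\<in>UNIV. wgt (\<theta> $ m)) = 1" by (simp add: rest_def wgt_def)
  then have "\<theta> \<in> Theta"
    using assms by (auto simp: Theta_def \<theta>_def rest_def wgt_def scl_def)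
  moreover have "subvector K \<theta> = t"
    using assms(2) by (auto simp: subvector_def \<theta>_def extensional_def restrict_def)
  ultimately show ?thesis using assms(5) unfolding Theta_bar_def by (force simp: subvector_def)
qed

lemma submixture_integral:
  assumes fam: "\<And>m. location_scale_family (f m)" and t: "t \<in> Theta_bar K"
  shows "integrable lebesgue (\<lambda>x. submixture f K x t)" "(\<integral>x. submixture f K x t \<partial>lebesgue) \<le> 1"
    "0 \<le> submixture f K x t"
proof -
  note F = location_scale_integral[OF fam Theta_bar_bounds(4)[OF t]]
  show "integrable lebesgue (\<lambda>x. submixture f K x t)"
    unfolding submixture_def using F by auto
  have "(\<integral>x. submixture f K x t \<partial>lebesgue) = (\<Sum>k\<in>K. wgt (t k))"
    unfolding submixture_def using F by (subst Bochner_Integration.integral_sum) auto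
  then show "(\<integral>x. submixture f K x t \<partial>lebesgue) \<le> 1" using Theta_bar_bounds(5)[OF t] by simp
  show "0 \<le> submixture f K x t"
    unfolding submixture_def using F(3) Theta_bar_bounds(2)[OF t]
    by (intro sum_nonneg mult_nonneg_nonneg)
qed

text \<open>A member of the class is only a version of a submixture; its measurability comes from the
  completeness of Lebesgue measure.\<close>

lemma G_set_integral:
  assumes fam: "\<And>m. location_scale_family (f m)" and g: "g \<in> G_set f K"
  shows "integrable lebesgue g" "(\<integral>x. g x \<partial>lebesgue) \<le> 1" "0 \<le> g x"
proof -
  obtain t where t: "t \<in> Theta_bar K" "AE x in lebesgue. g x = submixture f K x t"
    using g by (auto simp: G_set_def)
  have ae: "AE x in lebesgue. submixture f K x t = g x" using t(2) by (auto elim: eventually_mono)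
  note S = submixture_integral[of f, OF fam t(1)]
  have meas: "g \<in> borel_measurable lebesgue"
    using borel_measurable_AE[OF borel_measurable_integrable[OF S(1)] ae] .
  show "integrable lebesgue g" by (rule integrable_cong_AE_imp[OF S(1) meas ae])
  show "(\<integral>x. g x \<partial>lebesgue) \<le> 1"
    using S(2) integral_cong_AE[OF meas borel_measurable_integrable[OF S(1)] t(2)] by simp
  show "0 \<le> g x" using g by (simp add: G_set_def)
qed

section \<open>Compactness and the uniform deficit\<close>

text \<open>The limit weights sum to at most the limit of the total weights, which is at most \<open>1\<close>, so the
  limit parameter is admissible by \<open>Theta_barI\<close>.\<close>

lemma submixture_subsequence:
  fixes K :: "'m::finite set" and t :: "nat \<Rightarrow> 'm \<Rightarrow> component"
  assumes fam: "\<And>m. tail_bounded_family (f m) v\<^sub>0 v\<^sub>1 \<beta>"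
    and K: "K \<noteq> UNIV" and t: "\<And>n. t n \<in> Theta_bar K"
  shows "\<exists>r q. strict_mono r \<and> q \<in> Theta_bar K \<and>
    (AE x in lebesgue. (\<lambda>n. submixture f K x (t (r n))) \<longlonglongrightarrow> submixture f K x q)"
proof -
  have "\<exists>r q. strict_mono r \<and> (\<forall>k\<in>K. component_limit (f k) (\<lambda>n. t (r n) k) (q k))"
    by (rule simultaneous_subsequence[OF finite fam]) (use Theta_bar_bounds[OF t] in auto)
  then obtain r q where r: "strict_mono r"
    and q: "\<And>k. k \<in> K \<Longrightarrow> component_limit (f k) (\<lambda>n. t (r n) k) (q k)"
    by blast
  have "\<forall>k\<in>K. \<exists>a. wgt (q k) \<le> a \<and> (\<lambda>n. wgt (t (r n) k)) \<longlonglongrightarrow> a"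
    using q by (simp add: component_limit_def)
  from bchoice[OF this] obtain a
    where "\<forall>k\<in>K. wgt (q k) \<le> a k \<and> (\<lambda>n. wgt (t (r n) k)) \<longlonglongrightarrow> a k" ..
  then have a: "wgt (q k) \<le> a k" "(\<lambda>n. wgt (t (r n) k)) \<longlonglongrightarrow> a k" if "k \<in> K" for k
    using that by simp_all
  have "(\<lambda>n. \<Sum>k\<in>K. wgt (t (r n) k)) \<longlonglongrightarrow> (\<Sum>k\<in>K. a k)"
    by (intro tendsto_sum a)
  then have "(\<Sum>k\<in>K. a k) \<le> 1"
    using Theta_bar_bounds(5)[OF t] by (intro LIMSEQ_le_const2) auto
  moreover have "(\<Sum>k\<in>K. wgt (q k)) \<le> (\<Sum>k\<in>K. a k)" by (intro sum_mono a)
  ultimately have "restrict q K \<in> Theta_bar K"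
    using q by (intro Theta_barI K) (auto simp: component_limit_def)
  moreover have "AE x in lebesgue. \<forall>k\<in>K. (\<lambda>n. wgt (t (r n) k) * f k x (loc (t (r n) k)) (scl (t (r n) k)))
        \<longlonglongrightarrow> wgt (q k) * f k x (loc (q k)) (scl (q k))"
  proof (rule AE_ball_countable')
    show "AE x in lebesgue. (\<lambda>n. wgt (t (r n) k) * f k x (loc (t (r n) k)) (scl (t (r n) k)))
        \<longlonglongrightarrow> wgt (q k) * f k x (loc (q k)) (scl (q k))" if "k \<in> K" for k
      using q[OF that] by (simp add: component_limit_def)
  qed (simp add: countable_finite)
  then have "AE x in lebesgue. (\<lambda>n. submixture f K x (t (r n))) \<longlonglongrightarrow> submixture f K x (restrict q K)"
    unfolding submixture_def
  proof eventually_elim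
    case (elim x)
    then have "(\<lambda>n. \<Sum>k\<in>K. wgt (t (r n) k) * f k x (loc (t (r n) k)) (scl (t (r n) k)))
        \<longlonglongrightarrow> (\<Sum>k\<in>K. wgt (q k) * f k x (loc (q k)) (scl (q k)))"
      by (intro tendsto_sum) blast
    then show ?case by simp
  qed
  ultimately show ?thesis using r by blast
qed

text \<open>A vanishing deficit gives \<open>h \<le> g\<close> almost everywhere, and \<open>g\<close> has no more mass than \<open>h\<close>.\<close>

lemma AE_eq_if_deficit_zero:
  fixes h g :: "'a \<Rightarrow> real"
  assumes h: "integrable M h" "(\<integral>x. h x \<partial>M) = 1" "\<And>x. 0 \<le> h x"
    and g: "integrable M g" "(\<integral>x. g x \<partial>M) \<le> 1" "\<And>x. 0 \<le> g x"
    and D: "(\<integral>x. max 0 (h x - g x) \<partial>M) = 0"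
  shows "AE x in M. h x = g x"
proof -
  have "integrable M (\<lambda>x. max 0 (h x - g x))"
    by (rule integrable_deficit) (use h g in auto)
  then have "AE x in M. max 0 (h x - g x) = 0"
    using D by (subst (asm) integral_nonneg_eq_0_iff_AE) auto
  then have le: "AE x in M. 0 \<le> g x - h x" by eventually_elim (auto simp: max_def split: if_splits)
  then have "0 \<le> (\<integral>x. g x - h x \<partial>M)" by (rule integral_nonneg_AE)
  moreover have "(\<integral>x. g x - h x \<partial>M) = (\<integral>x. g x \<partial>M) - 1" using h g by simp
  ultimately have "(\<integral>x. g x - h x \<partial>M) = 0" using g(2) by simp
  then have "AE x in M. g x - h x = 0"
    using le h g by (subst (asm) integral_nonneg_eq_0_iff_AE) auto
  then show ?thesis by eventually_elim simp
qed

text \<open>Otherwise some sequence in the class has deficits tending to \<open>0\<close>, and a subsequential limit has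
  deficit \<open>0\<close>. It suffices that the limit exists almost everywhere, since \<open>h\<close> dominates
  every \<open>max 0 (h - g)\<close>.\<close>

lemma deficit_bounded_below:
  fixes K :: "'m::finite set"
  assumes fam: "\<And>m. tail_bounded_family (f m) v\<^sub>0 v\<^sub>1 \<beta>" and K: "K \<noteq> UNIV"
    and h: "integrable lebesgue h" "(\<integral>x. h x \<partial>lebesgue) = 1" "\<And>x. 0 \<le> h x"
    and h_notin: "h \<notin> G_set f K"
  shows "\<exists>\<delta>>0. \<forall>g\<in>G_set f K. \<delta> \<le> (\<integral>x. max 0 (h x - g x) \<partial>lebesgue)"
proof (rule ccontr)
  assume "\<not> ?thesis"
  then have "\<exists>g\<in>G_set f K. (\<integral>x. max 0 (h x - g x) \<partial>lebesgue) < inverse (real (Suc n))" for n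
    by (metis inverse_positive_iff_positive not_le of_nat_0_less_iff zero_less_Suc)
  then obtain g where g: "\<And>n. g n \<in> G_set f K"
    and small: "\<And>n. (\<integral>x. max 0 (h x - g n x) \<partial>lebesgue) < inverse (real (Suc n))"
    by metis
  have ls: "\<And>m. location_scale_family (f m)" using fam by (simp add: tail_bounded_family_def)
  note gi = G_set_integral[of f, OF ls g]
  have "\<exists>t. \<forall>n. t n \<in> Theta_bar K \<and> (AE x in lebesgue. g n x = submixture f K x (t n))"
    using g by (intro choice) (auto simp: G_set_def)
  then obtain t where t: "\<And>n. t n \<in> Theta_bar K"
    and gt: "\<And>n. AE x in lebesgue. g n x = submixture f K x (t n)" by blast
  obtain r q where r: "strict_mono r" and q: "q \<in> Theta_bar K"
    and lim: "AE x in lebesgue. (\<lambda>n. submixture f K x (t (r n))) \<longlonglongrightarrow> submixture f K x q"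
    using submixture_subsequence[of f v\<^sub>0 v\<^sub>1 \<beta> K t] fam K t by blast
  note S = submixture_integral[of f, OF ls q]
  have "AE x in lebesgue. \<forall>n. g n x = submixture f K x (t n)"
    using gt by (simp add: AE_all_countable)
  with lim have lim': "AE x in lebesgue. (\<lambda>n. g (r n) x) \<longlonglongrightarrow> submixture f K x q"
    by eventually_elim simp
  have "(\<lambda>n. \<integral>x. max 0 (h x - g (r n) x) \<partial>lebesgue)
      \<longlonglongrightarrow> (\<integral>x. max 0 (h x - submixture f K x q) \<partial>lebesgue)"
  proof (rule integral_dominated_convergence[OF _ _ h(1)])
    show "AE x in lebesgue. (\<lambda>n. max 0 (h x - g (r n) x)) \<longlonglongrightarrow> max 0 (h x - submixture f K x q)"
      using lim' by eventually_elim (intro tendsto_intros)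
    show "AE x in lebesgue. norm (max 0 (h x - g (r n) x)) \<le> h x" for n
      using h(3) gi(3) by (intro AE_I2) (auto simp: max_def)
  qed (use integrable_deficit h gi S in \<open>auto intro!: borel_measurable_integrable\<close>)
  moreover have "(\<lambda>n. \<integral>x. max 0 (h x - g (r n) x) \<partial>lebesgue) \<longlonglongrightarrow> 0"
  proof (rule tendsto_sandwich[OF _ _ tendsto_const])
    show "\<forall>\<^sub>F n in sequentially. 0 \<le> (\<integral>x. max 0 (h x - g (r n) x) \<partial>lebesgue)" by simp
    show "\<forall>\<^sub>F n in sequentially. (\<integral>x. max 0 (h x - g (r n) x) \<partial>lebesgue) \<le> inverse (real (Suc (r n)))"
      using small by (simp add: less_imp_le)
    show "(\<lambda>n. inverse (real (Suc (r n)))) \<longlonglongrightarrow> 0"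
      using LIMSEQ_subseq_LIMSEQ[OF LIMSEQ_inverse_real_of_nat r] by (simp add: o_def)
  qed
  ultimately have "(\<integral>x. max 0 (h x - submixture f K x q) \<partial>lebesgue) = 0"
    by (rule LIMSEQ_unique)
  then have "AE x in lebesgue. h x = submixture f K x q"
    using h S by (intro AE_eq_if_deficit_zero) auto
  then show False using h_notin h(3) q by (auto simp: G_set_def)
qed

section \<open>From mixtures to single components\<close>

text \<open>Continuity is assumed for the whole mixture only. A mixture with all its weight on one component
  is that component, so continuity of the mixture contains continuity of each family.\<close>

definition pure_component :: "'m::finite \<Rightarrow> real \<Rightarrow> real \<Rightarrow> component ^ 'm" where
  "pure_component m \<mu> \<sigma> = (\<chi> j. if j = m then (1, \<mu>, \<sigma>) else (0, 0, 1))"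

lemma pure_component_in_Theta: "0 < \<sigma> \<Longrightarrow> pure_component m \<mu> \<sigma> \<in> Theta"
proof -
  have "(\<Sum>j\<in>UNIV. wgt (pure_component m \<mu> \<sigma> $ j)) = (\<Sum>j\<in>UNIV. if j = m then 1 else 0)"
    by (intro sum.cong) (auto simp: pure_component_def wgt_def)
  then show "0 < \<sigma> \<Longrightarrow> pure_component m \<mu> \<sigma> \<in> Theta"
    by (simp add: Theta_def) (simp add: pure_component_def wgt_def scl_def)
qed

lemma mixture_pure_component: "mixture f x (pure_component m \<mu> \<sigma>) = f m x \<mu> \<sigma>"
proof -
  have "mixture f x (pure_component m \<mu> \<sigma>) = (\<Sum>j\<in>UNIV. if j = m then f m x \<mu> \<sigma> else 0)"
    unfolding mixture_def by (intro sum.cong) (auto simp: pure_component_def wgt_def loc_def scl_def)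
  then show ?thesis by simp
qed

lemma component_continuity:
  fixes f :: "'m::finite \<Rightarrow> real \<Rightarrow> real \<Rightarrow> real \<Rightarrow> real"
  assumes cont: "\<And>\<Gamma> \<theta>. compact \<Gamma> \<Longrightarrow> \<Gamma> \<subseteq> Theta \<Longrightarrow> \<theta> \<in> \<Gamma> \<Longrightarrow>
      \<exists>N \<in> null_sets lebesgue. \<forall>\<theta>s. (\<forall>j. \<theta>s j \<in> \<Gamma>) \<longrightarrow> \<theta>s \<longlonglongrightarrow> \<theta> \<longrightarrow>
        (\<forall>x. x \<notin> N \<longrightarrow> (\<lambda>j. mixture f x (\<theta>s j)) \<longlonglongrightarrow> mixture f x \<theta>)"
    and lims: "\<mu>s \<longlonglongrightarrow> \<mu>" "\<sigma>s \<longlonglongrightarrow> \<sigma>" and pos: "\<And>n. 0 < \<sigma>s n" "0 < \<sigma>"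
  shows "AE x in lebesgue. (\<lambda>n. f m x (\<mu>s n) (\<sigma>s n)) \<longlonglongrightarrow> f m x \<mu> \<sigma>"
proof -
  define \<theta>s where "\<theta>s = (\<lambda>n. pure_component m (\<mu>s n) (\<sigma>s n))"
  define \<theta> where "\<theta> = pure_component m \<mu> \<sigma>"
  have lim: "\<theta>s \<longlonglongrightarrow> \<theta>"
    unfolding \<theta>s_def \<theta>_def pure_component_def
    by (intro vec_tendstoI) (auto intro!: tendsto_Pair tendsto_const lims)
  \<comment> \<open>A convergent sequence together with its limit is a compact parameter set.\<close>
  have "insert \<theta> (range \<theta>s) \<subseteq> Theta"
    using pos by (auto simp: \<theta>s_def \<theta>_def pure_component_in_Theta)
  then obtain N where N: "N \<in> null_sets lebesgue"
    "\<And>x. x \<notin> N \<Longrightarrow> (\<lambda>j. mixture f x (\<theta>s j)) \<longlonglongrightarrow> mixture f x \<theta>"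
    using cont[OF compact_sequence_with_limit[OF lim], of \<theta>] lim by blast
  have "AE x in lebesgue. x \<notin> N" using N(1) by (rule AE_not_in)
  then show ?thesis
    by eventually_elim (use N(2) in \<open>simp add: \<theta>s_def \<theta>_def mixture_pure_component\<close>)
qed

section \<open>The uniform gap for mixtures with fewer components\<close>

lemma expect_under_eq_integral:
  assumes fam: "\<And>m. location_scale_family (f m)" and \<theta>: "\<theta> \<in> Theta"
    and "u \<in> borel_measurable lebesgue"
  shows "expect_under f \<theta> u = (\<integral>x. mixture f x \<theta> * u x \<partial>lebesgue)"
  unfolding expect_under_def using assms mixture_integral[of f, OF fam \<theta>]
  by (subst integral_density) auto

theorem theorem1:
  fixes f :: "'m::finite \<Rightarrow> real \<Rightarrow> real \<Rightarrow> real \<Rightarrow> real"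
    and \<theta>\<^sub>0 :: "component ^ 'm"
    and v\<^sub>0 v\<^sub>1 \<beta> :: real
  assumes fam: "\<And>m. location_scale_family (f m)"
    and th0: "\<theta>\<^sub>0 \<in> Theta"
    and vpos: "v\<^sub>0 > 0" "v\<^sub>1 > 0" "\<beta> > 1"
    \<comment> \<open>The second bound is void at \<open>x = 0\<close>, where \<open>0 powr - \<beta>\<close> would be \<open>0\<close> instead of infinity.\<close>
    and bound: "\<And>m x. f m x 0 1 \<le> v\<^sub>0 \<and> (x \<noteq> 0 \<longrightarrow> f m x 0 1 \<le> v\<^sub>1 * \<bar>x\<bar> powr (- \<beta>))"
    and sup_meas: "\<And>\<Gamma> \<theta>. compact \<Gamma> \<Longrightarrow> \<Gamma> \<subseteq> Theta \<Longrightarrow> \<theta> \<in> \<Gamma> \<Longrightarrow>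
      \<forall>\<^sub>F \<rho> in at_right 0. (\<lambda>x. mixture_sup f x \<theta> \<rho>) \<in> borel_measurable lebesgue"
    and cont: "\<And>\<Gamma> \<theta>. compact \<Gamma> \<Longrightarrow> \<Gamma> \<subseteq> Theta \<Longrightarrow> \<theta> \<in> \<Gamma> \<Longrightarrow>
      \<exists>N \<in> null_sets lebesgue. \<forall>\<theta>s. (\<forall>j. \<theta>s j \<in> \<Gamma>) \<longrightarrow> \<theta>s \<longlonglongrightarrow> \<theta> \<longrightarrow>
        (\<forall>x. x \<notin> N \<longrightarrow> (\<lambda>j. mixture f x (\<theta>s j)) \<longlonglongrightarrow> mixture f x \<theta>)"
    and log_int: "integrable lebesgue (\<lambda>x. \<bar>ln (mixture f x \<theta>\<^sub>0)\<bar> * mixture f x \<theta>\<^sub>0)"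
    and f0: "(\<lambda>x. mixture f x \<theta>\<^sub>0) \<in> G_upto f CARD('m) - G_upto f (CARD('m) - 1)"
  shows "\<exists>\<kappa> l. \<kappa> > 0 \<and> l > 0 \<and>
    (\<forall>g \<in> G_upto f (CARD('m) - 1).
       expect_under f \<theta>\<^sub>0 (\<lambda>x. ln (g x + \<kappa>)) + l < expect_under f \<theta>\<^sub>0 (\<lambda>x. ln (mixture f x \<theta>\<^sub>0)))"
proof -
  define h where "h = (\<lambda>x. mixture f x \<theta>\<^sub>0)"
  have h: "integrable lebesgue h" "(\<integral>x. h x \<partial>lebesgue) = 1" "\<And>x. 0 \<le> h x"
    unfolding h_def by (rule mixture_integral[of f, OF fam th0])+
  have hx: "mixture f x \<theta>\<^sub>0 = h x" for x by (simp add: h_def)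
  have families: "tail_bounded_family (f m) v\<^sub>0 v\<^sub>1 \<beta>" for m
  proof unfold_locales
    show "AE x in lebesgue. (\<lambda>n. f m x (\<mu>s n) (\<sigma>s n)) \<longlonglongrightarrow> f m x \<mu> \<sigma>"
      if "\<mu>s \<longlonglongrightarrow> \<mu>" "\<sigma>s \<longlonglongrightarrow> \<sigma>" "\<And>n. 0 < \<sigma>s n" "0 < \<sigma>" for \<mu>s \<sigma>s \<mu> \<sigma>
      by (rule component_continuity[OF cont that])
  qed (use fam vpos bound in auto)
  have proper: "card K \<le> CARD('m) - 1 \<longleftrightarrow> K \<noteq> UNIV" for K :: "'m set"
  proof -
    have "card K < CARD('m)" if "K \<noteq> UNIV" using that by (intro psubset_card_mono) auto
    moreover obtain n where "CARD('m) = Suc n"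
      using gr0_implies_Suc[OF zero_less_card_finite[where 'a = 'm]] by blast
    ultimately show ?thesis by (cases "K = UNIV") auto
  qed
  have "\<exists>\<delta>>0. \<forall>g\<in>G_set f K. \<delta> \<le> (\<integral>x. max 0 (h x - g x) \<partial>lebesgue)" if "K \<noteq> UNIV" for K
  proof (rule deficit_bounded_below[OF families that h(1,2)])
    show "h \<notin> G_set f K" using f0 that proper[of K] unfolding G_upto_def h_def by blast
  qed (rule h(3))
  then obtain d where d: "\<And>K. K \<noteq> UNIV \<Longrightarrow> 0 < d K"
    "\<And>K g. K \<noteq> UNIV \<Longrightarrow> g \<in> G_set f K \<Longrightarrow> d K \<le> (\<integral>x. max 0 (h x - g x) \<partial>lebesgue)"
    by metis
  define \<delta> where "\<delta> = Min (d ` {K. K \<noteq> UNIV})"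
  have "{K :: 'm set. K \<noteq> UNIV} \<noteq> {}" by auto
  then have \<delta>: "0 < \<delta>" unfolding \<delta>_def using d(1) by (subst Min_gr_iff) auto
  have \<delta>_le: "\<delta> \<le> d K" if "K \<noteq> UNIV" for K unfolding \<delta>_def using that by (intro Min_le) auto
  obtain \<kappa> l where \<kappa>: "0 < \<kappa>" "0 < l"
    and gap: "\<And>g. integrable lebesgue g \<Longrightarrow> (\<forall>x. 0 \<le> g x) \<Longrightarrow> (\<integral>x. g x \<partial>lebesgue) \<le> 1 \<Longrightarrow>
       \<delta> \<le> (\<integral>x. max 0 (h x - g x) \<partial>lebesgue) \<Longrightarrow>
       (\<integral>x. h x * ln (g x + \<kappa>) \<partial>lebesgue) + l < (\<integral>x. h x * ln (h x) \<partial>lebesgue)"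
    using log_gap_from_deficit[OF h(1,3,2) log_int[unfolded hx] \<delta>] by blast
  have "expect_under f \<theta>\<^sub>0 (\<lambda>x. ln (g x + \<kappa>)) + l < expect_under f \<theta>\<^sub>0 (\<lambda>x. ln (mixture f x \<theta>\<^sub>0))"
    if g: "g \<in> G_upto f (CARD('m) - 1)" for g
  proof -
    obtain K where K: "K \<noteq> UNIV" "g \<in> G_set f K" using g proper unfolding G_upto_def by blast
    note gi = G_set_integral[of f, OF fam K(2)]
    note [measurable] = borel_measurable_integrable[OF gi(1)] borel_measurable_integrable[OF h(1)]
    have "\<delta> \<le> (\<integral>x. max 0 (h x - g x) \<partial>lebesgue)"
      using \<delta>_le[OF K(1)] d(2)[OF K] by simp
    then have "(\<integral>x. h x * ln (g x + \<kappa>) \<partial>lebesgue) + l < (\<integral>x. h x * ln (h x) \<partial>lebesgue)"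
      using gi by (intro gap) auto
    then show ?thesis
      unfolding hx by (simp add: expect_under_eq_integral[of f, OF fam th0, unfolded hx])
  qed
  then show ?thesis using \<kappa> by blast
qed

end
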